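(* Let $V>0$. There exist design points $x_1<\dots<x_n$ that depend on $V$ such that for any estimator $\hat\mu$, $$\sup_{\mu\in\mathcal{K}^C_{x_1,\dots,x_n}\cap\mathcal{S}_n^\uparrow:\ \mu_n-\mu_1\le2V}\mathbb{P}_\mu\left(\|\hat\mu-\mu\|^2\ge C\sigma^2\left(\frac{V^2}{\sigma^2n^2}\right)^{1/3}\right)\ge c,$$ where $c,C>0$ are absolute constants.
   Context: Scaled norm: $\|v\|^2=\frac1n\sum_{i=1}^n v_i^2$ for $v\in\mathbb{R}^n$. $\mathbb{P}_\mu$ is the probability under which one observes $y=\mu+\xi$ with $\xi\sim\mathcal{N}(0,\sigma^2I_{n\times n})$, $\sigma>0$; an estimator $\hat\mu$ is a function of $y$ with values in $\mathbb{R}^n$. $\mathcal{S}_n^\uparrow=\{u\in\mathbb{R}^n: u_i\le u_{i+1},\ i=1,\dots,n-1\}$ is the set of nondecreasing sequences. For real numbers $x_1<\dots<x_n$ (design points), $\mathcal{K}^C_{x_1,\dots,x_n}=\left\{u\in\mathbb{R}^n:\ \frac{u_i-u_{i-1}}{x_i-x_{i-1}}\le\frac{u_{i+1}-u_i}{x_{i+1}-x_i},\ i=2,\dots,n-1\right\}$, i.e. the set of vectors $(f(x_1),\dots,f(x_n))^T$ with $f:\mathbb{R}\to\mathbb{R}$ convex.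
   Formalization: The hypothesis V ≤ σn is added: without it the claim fails, since for the estimator μ̂ = y and n, σ fixed the probability tends to 0 as V → ∞, so no absolute constants c, C exist; estimators are taken to be Borel measurable. *)

theory Defs
  imports "HOL-Probability.Probability"
begin

text \<open>A vector of \<open>\<real>\<^sup>n\<close> is a function on the index set \<open>{1..n}\<close> that is \<open>undefined\<close> elsewhere,
  so that \<open>\<real>\<^sup>n\<close> with its Borel sets is a product measurable space and \<open>n\<close> can be quantified.\<close>

definition Rn :: "nat \<Rightarrow> (nat \<Rightarrow> real) measure" where
  "Rn n = (\<Pi>\<^sub>M i\<in>{1..n}. borel)"

definition scaled_norm_sq :: "nat \<Rightarrow> (nat \<Rightarrow> real) \<Rightarrow> real" where
  "scaled_norm_sq n v = (1 / real n) * (\<Sum>i=1..n. (v i)\<^sup>2)"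

definition gaussian_noise :: "nat \<Rightarrow> real \<Rightarrow> (nat \<Rightarrow> real) measure" where
  "gaussian_noise n \<sigma> = (\<Pi>\<^sub>M i\<in>{1..n}. density lborel (\<lambda>t. ennreal (normal_density 0 \<sigma> t)))"

definition obs_law :: "nat \<Rightarrow> real \<Rightarrow> (nat \<Rightarrow> real) \<Rightarrow> (nat \<Rightarrow> real) measure" where
  "obs_law n \<sigma> \<mu> = distr (gaussian_noise n \<sigma>) (Rn n) (\<lambda>\<xi>. \<lambda>i\<in>{1..n}. \<mu> i + \<xi> i)"

definition nondecreasing_seqs :: "nat \<Rightarrow> (nat \<Rightarrow> real) set" where
  "nondecreasing_seqs n = {u \<in> space (Rn n). \<forall>i\<in>{1..<n}. u i \<le> u (i + 1)}"

definition convex_seqs :: "nat \<Rightarrow> (nat \<Rightarrow> real) \<Rightarrow> (nat \<Rightarrow> real) set" where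
  "convex_seqs n x = {u \<in> space (Rn n). \<forall>i\<in>{2..<n}.
     (u i - u (i - 1)) / (x i - x (i - 1)) \<le> (u (i + 1) - u i) / (x (i + 1) - x i)}"

end

theory Submission
  imports Defs
begin

text \<open>Convexity costs nothing: if the increments of all sequences of a family lie in \<open>[a, b]\<close> with \<open>a > 0\<close>,
  then geometrically shrinking gaps between the design points make the whole family convex. It
  therefore suffices to use Assouad's hypercube for isotonic regression, a linear trend plus a staircase
  with \<open>n / m\<close> steps of height \<open>\<delta>\<close>, each of which is optionally raised by \<open>\<delta>\<close>. With \<open>m \<delta>\<^sup>2 = \<sigma>\<^sup>2 / 4\<close>
  raising one block is not detectable, so on average a quarter of the blocks is estimated
  badly; as the fraction of bad blocks is bounded by 1, it is of constant order with constant
  probability.\<close>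

section \<open>Gaussian observation laws as densities on a product space\<close>

lemma PiM_density_finite:
  assumes "finite I" and "\<And>i. i \<in> I \<Longrightarrow> f i \<in> borel_measurable M"
    and "sigma_finite_measure M" and "\<And>i. sigma_finite_measure (density M (f i))"
  shows "(\<Pi>\<^sub>M i\<in>I. density M (f i)) = density (\<Pi>\<^sub>M i\<in>I. M) (\<lambda>y. \<Prod>i\<in>I. f i (y i))"
proof -
  interpret M: product_sigma_finite "\<lambda>_. M"
    using assms(3) by (simp add: product_sigma_finite_def)
  interpret D: product_sigma_finite "\<lambda>i. density M (f i)"
    using assms(4) by (simp add: product_sigma_finite_def)
  have meas [measurable]: "(\<lambda>y. \<Prod>i\<in>I. f i (y i)) \<in> borel_measurable (\<Pi>\<^sub>M i\<in>I. M)"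
    using assms(2) by (intro borel_measurable_prod_ennreal)
      (auto intro: measurable_compose[OF measurable_component_singleton])
  have sets_eq: "sets (\<Pi>\<^sub>M i\<in>I. density M (f i)) = sets (\<Pi>\<^sub>M i\<in>I. M)"
    by (intro sets_PiM_cong) auto
  \<comment> \<open>A product measure is determined by its values on boxes; there both the density
    and the indicator factorize over coordinates, and Tonelli splits the integral.\<close>
  show ?thesis
  proof (rule D.PiM_eqI[symmetric])
    fix A assume "\<And>i. i \<in> I \<Longrightarrow> A i \<in> sets (density M (f i))"
    then have A [measurable]: "\<And>i. i \<in> I \<Longrightarrow> A i \<in> sets M" by simp
    have box: "Pi\<^sub>E I A \<in> sets (\<Pi>\<^sub>M i\<in>I. M)"
      using A assms(1) by (intro sets_PiM_I_finite) auto
    have "emeasure (density (\<Pi>\<^sub>M i\<in>I. M) (\<lambda>y. \<Prod>i\<in>I. f i (y i))) (Pi\<^sub>E I A)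
        = (\<integral>\<^sup>+y. (\<Prod>i\<in>I. f i (y i)) * indicator (Pi\<^sub>E I A) y \<partial>(\<Pi>\<^sub>M i\<in>I. M))"
      using box by (simp add: emeasure_density)
    also have "\<dots> = (\<integral>\<^sup>+y. (\<Prod>i\<in>I. f i (y i) * indicator (A i) (y i)) \<partial>(\<Pi>\<^sub>M i\<in>I. M))"
    proof (rule nn_integral_cong)
      fix y assume "y \<in> space (\<Pi>\<^sub>M i\<in>I. M)"
      then have "(indicator (Pi\<^sub>E I A) y :: ennreal) = (\<Prod>i\<in>I. indicator (A i) (y i))"
        using assms(1) by (auto simp: indicator_def space_PiM PiE_iff)
      then show "(\<Prod>i\<in>I. f i (y i)) * indicator (Pi\<^sub>E I A) y
          = (\<Prod>i\<in>I. f i (y i) * indicator (A i) (y i))"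
        by (simp add: prod.distrib)
    qed
    also have "\<dots> = (\<Prod>i\<in>I. \<integral>\<^sup>+x. f i x * indicator (A i) x \<partial>M)"
      using A assms(2) by (intro M.product_nn_integral_prod assms(1)) auto
    also have "\<dots> = (\<Prod>i\<in>I. emeasure (density M (f i)) (A i))"
      using A assms(2) by (intro prod.cong) (auto simp: emeasure_density)
    finally show "emeasure (density (\<Pi>\<^sub>M i\<in>I. M) (\<lambda>y. \<Prod>i\<in>I. f i (y i))) (Pi\<^sub>E I A)
        = (\<Prod>i\<in>I. emeasure (density M (f i)) (A i))" .
  qed (simp_all add: assms(1) sets_eq)
qed

lemma distr_normal_density_add:
  "distr (density lborel (\<lambda>t. ennreal (normal_density 0 \<sigma> t))) borel ((+) m)
    = density lborel (\<lambda>t. ennreal (normal_density m \<sigma> t))"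
proof -
  have "density lborel (\<lambda>t. ennreal (normal_density m \<sigma> t))
      = density (distr lborel borel ((+) m)) (\<lambda>t. ennreal (normal_density m \<sigma> t))"
    by (simp add: lborel_distr_plus)
  also have "\<dots> = distr (density lborel (\<lambda>t. ennreal (normal_density m \<sigma> (m + t)))) borel ((+) m)"
    by (subst density_distr) auto
  finally show ?thesis by (simp add: normal_density_def)
qed

text \<open>Shifting product noise shifts every factor, and Lebesgue measure is translation
  invariant. All means thus share one dominating measure, so that likelihoods can be compared
  pointwise.\<close>

lemma obs_law_eq_density:
  assumes "\<sigma> > 0"
  shows "obs_law n \<sigma> \<mu> =
    density (\<Pi>\<^sub>M i\<in>{1..n}. lborel) (\<lambda>y. \<Prod>i\<in>{1..n}. ennreal (normal_density (\<mu> i) \<sigma> (y i)))"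
proof -
  let ?G = "\<lambda>m. density lborel (\<lambda>t. ennreal (normal_density m \<sigma> t))"
  have sf: "sigma_finite_measure (?G m)" for m
    using prob_space_normal_density[OF assms, of m]
    by (intro prob_space_imp_sigma_finite)
  interpret G: product_sigma_finite "\<lambda>_. ?G 0"
    using sf by (simp add: product_sigma_finite_def)
  interpret H: product_sigma_finite "\<lambda>i. ?G (\<mu> i)"
    using sf by (simp add: product_sigma_finite_def)
  have sets_G: "sets (\<Pi>\<^sub>M i\<in>{1..n}. ?G (\<nu> i)) = sets (Rn n)" for \<nu> :: "nat \<Rightarrow> real"
    unfolding Rn_def by (intro sets_PiM_cong) auto
  have shift: "(\<lambda>\<xi>. \<lambda>i\<in>{1..n}. \<mu> i + \<xi> i) \<in> measurable (\<Pi>\<^sub>M i\<in>{1..n}. ?G 0) (Rn n)"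
    unfolding Rn_def by measurable
  have "obs_law n \<sigma> \<mu> = (\<Pi>\<^sub>M i\<in>{1..n}. ?G (\<mu> i))"
    unfolding obs_law_def gaussian_noise_def
  proof (rule H.PiM_eqI)
    fix A assume "\<And>i. i \<in> {1..n} \<Longrightarrow> A i \<in> sets (?G (\<mu> i))"
    then have A [measurable]: "\<And>i. i \<in> {1..n} \<Longrightarrow> A i \<in> sets borel" by simp
    have box: "Pi\<^sub>E {1..n} A \<in> sets (Rn n)"
      unfolding Rn_def using A by (intro sets_PiM_I_finite) auto
    have pre: "(\<lambda>\<xi>. \<lambda>i\<in>{1..n}. \<mu> i + \<xi> i) -` Pi\<^sub>E {1..n} A \<inter> space (\<Pi>\<^sub>M i\<in>{1..n}. ?G 0)
        = Pi\<^sub>E {1..n} (\<lambda>i. (+) (\<mu> i) -` A i)"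
      by (auto simp: space_PiM PiE_iff)
    have "emeasure (distr (\<Pi>\<^sub>M i\<in>{1..n}. ?G 0) (Rn n) (\<lambda>\<xi>. \<lambda>i\<in>{1..n}. \<mu> i + \<xi> i)) (Pi\<^sub>E {1..n} A)
        = emeasure (\<Pi>\<^sub>M i\<in>{1..n}. ?G 0) (Pi\<^sub>E {1..n} (\<lambda>i. (+) (\<mu> i) -` A i))"
      by (simp only: emeasure_distr[OF shift box] pre)
    also have "\<dots> = (\<Prod>i\<in>{1..n}. emeasure (?G 0) ((+) (\<mu> i) -` A i))"
      using A by (intro G.emeasure_PiM) (auto intro!: measurable_sets_borel[where M=borel])
    also have "\<dots> = (\<Prod>i\<in>{1..n}. emeasure (?G (\<mu> i)) (A i))"
    proof (rule prod.cong)
      fix i assume "i \<in> {1..n}"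
      then show "emeasure (?G 0) ((+) (\<mu> i) -` A i) = emeasure (?G (\<mu> i)) (A i)"
        using A by (subst distr_normal_density_add[of \<sigma> "\<mu> i", symmetric], subst emeasure_distr) auto
    qed simp
    finally show "emeasure (distr (\<Pi>\<^sub>M i\<in>{1..n}. ?G 0) (Rn n) (\<lambda>\<xi>. \<lambda>i\<in>{1..n}. \<mu> i + \<xi> i)) (Pi\<^sub>E {1..n} A)
        = (\<Prod>i\<in>{1..n}. emeasure (?G (\<mu> i)) (A i))" .
  qed (simp_all only: sets_distr sets_G finite_atLeastAtMost)
  also have "\<dots> = density (\<Pi>\<^sub>M i\<in>{1..n}. lborel)
      (\<lambda>y. \<Prod>i\<in>{1..n}. ennreal (normal_density (\<mu> i) \<sigma> (y i)))"
    using sf by (intro PiM_density_finite) (auto intro: sigma_finite_lborel)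
  finally show ?thesis .
qed

lemma sets_obs_law [simp]: "sets (obs_law n \<sigma> \<mu>) = sets (Rn n)"
  by (simp add: obs_law_def)

lemma space_obs_law [simp]: "space (obs_law n \<sigma> \<mu>) = space (Rn n)"
  by (simp add: obs_law_def)

lemma prob_space_obs_law:
  assumes "\<sigma> > 0"
  shows "prob_space (obs_law n \<sigma> \<mu>)"
  unfolding obs_law_def gaussian_noise_def
  by (intro prob_space.prob_space_distr prob_space_PiM prob_space_normal_density assms)
     (auto simp: Rn_def)

section \<open>Comparison of two Gaussian laws\<close>

text \<open>The points \<open>a\<close> and \<open>2 * b - a\<close> are symmetric about
  \<open>b\<close>, so this is the parallelogram identity in the exponents.\<close>

lemma normal_density_square:
  assumes "\<sigma> > 0"
  shows "(normal_density b \<sigma> t)\<^sup>2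
    = exp ((b - a)\<^sup>2 / \<sigma>\<^sup>2) * normal_density (2 * b - a) \<sigma> t * normal_density a \<sigma> t"
proof -
  have "- (t - b)\<^sup>2 / (2 * \<sigma>\<^sup>2) + - (t - b)\<^sup>2 / (2 * \<sigma>\<^sup>2)
     = (b - a)\<^sup>2 / \<sigma>\<^sup>2 + - (t - (2 * b - a))\<^sup>2 / (2 * \<sigma>\<^sup>2) + - (t - a)\<^sup>2 / (2 * \<sigma>\<^sup>2)"
    using assms by (simp add: field_simps power2_eq_square)
  then have "exp (- (t - b)\<^sup>2 / (2 * \<sigma>\<^sup>2)) * exp (- (t - b)\<^sup>2 / (2 * \<sigma>\<^sup>2))
     = exp ((b - a)\<^sup>2 / \<sigma>\<^sup>2) * exp (- (t - (2 * b - a))\<^sup>2 / (2 * \<sigma>\<^sup>2)) * exp (- (t - a)\<^sup>2 / (2 * \<sigma>\<^sup>2))"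
    by (simp flip: exp_add)
  then show ?thesis
    unfolding normal_density_def by (simp add: power2_eq_square)
qed

text \<open>For densities \<open>p\<close>, \<open>q\<close> one has \<open>q \<le> p + q\<^sup>2 / (4 p)\<close>, and for Gaussian densities \<open>q\<^sup>2 / p\<close> is
  again a multiple of a Gaussian density, with the reflected mean.\<close>

lemma measure_obs_law_le:
  assumes "\<sigma> > 0" and A: "A \<in> sets (Rn n)"
  shows "measure (obs_law n \<sigma> \<nu>) A
    \<le> measure (obs_law n \<sigma> \<mu>) A + exp ((\<Sum>i=1..n. (\<nu> i - \<mu> i)\<^sup>2) / \<sigma>\<^sup>2) / 4"
proof -
  let ?L = "\<Pi>\<^sub>M i\<in>{1..n}. lborel :: real measure"
  let ?d = "\<lambda>\<mu> y. \<Prod>i\<in>{1..n}. normal_density (\<mu> i) \<sigma> (y i)"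
  let ?r = "\<lambda>i. 2 * \<nu> i - \<mu> i"
  define E where "E = exp ((\<Sum>i=1..n. (\<nu> i - \<mu> i)\<^sup>2) / \<sigma>\<^sup>2)"
  have E_pos: "E > 0" by (simp add: E_def)
  have sets_L: "sets ?L = sets (Rn n)"
    unfolding Rn_def by (intro sets_PiM_cong) auto
  have meas: "(\<lambda>y. ?d \<rho> y) \<in> borel_measurable ?L" for \<rho> :: "nat \<Rightarrow> real"
    by measurable
  have meas_A: "(\<lambda>y. ennreal (?d \<rho> y) * indicator A y) \<in> borel_measurable ?L" for \<rho> :: "nat \<Rightarrow> real"
    using A sets_L by (intro borel_measurable_times_ennreal measurable_compose[OF meas]
        borel_measurable_indicator) auto
  have em: "emeasure (obs_law n \<sigma> \<rho>) A = (\<integral>\<^sup>+y. ennreal (?d \<rho> y) * indicator A y \<partial>?L)"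
    for \<rho> :: "nat \<Rightarrow> real"
    using A sets_L meas[of \<rho>]
    by (simp add: obs_law_eq_density[OF assms(1)] prod_ennreal emeasure_density)
  have ptw: "?d \<nu> y \<le> ?d \<mu> y + E / 4 * ?d ?r y" for y
  proof -
    have pos: "?d \<mu> y > 0" using assms(1) by (intro prod_pos) (auto intro: normal_density_pos)
    have "(?d \<nu> y)\<^sup>2 = (\<Prod>i\<in>{1..n}. (normal_density (\<nu> i) \<sigma> (y i))\<^sup>2)"
      by (simp add: prod_power_distrib)
    also have "\<dots> = (\<Prod>i\<in>{1..n}. exp ((\<nu> i - \<mu> i)\<^sup>2 / \<sigma>\<^sup>2)) * ?d ?r y * ?d \<mu> y"
      unfolding prod.distrib[symmetric] by (intro prod.cong normal_density_square assms(1) refl)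
    also have "(\<Prod>i\<in>{1..n}. exp ((\<nu> i - \<mu> i)\<^sup>2 / \<sigma>\<^sup>2)) = E"
      unfolding E_def sum_divide_distrib by (simp add: exp_sum)
    finally have sq: "(?d \<nu> y)\<^sup>2 = E * ?d ?r y * ?d \<mu> y" .
    \<comment> \<open>By \<open>sq\<close> the expanded square has the factor
      \<open>?d \<mu> y\<close>; cancelling this positive factor leaves exactly the linear
      bound.\<close>
    have "0 \<le> (?d \<nu> y - 2 * ?d \<mu> y)\<^sup>2" by simp
    also have "\<dots> = (?d \<nu> y)\<^sup>2 - 4 * ?d \<nu> y * ?d \<mu> y + 4 * (?d \<mu> y)\<^sup>2"
      by (simp add: power2_eq_square algebra_simps)
    also have "\<dots> = ?d \<mu> y * (E * ?d ?r y - 4 * ?d \<nu> y + 4 * ?d \<mu> y)"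
      unfolding sq by (simp add: power2_eq_square algebra_simps)
    finally have "0 \<le> E * ?d ?r y - 4 * ?d \<nu> y + 4 * ?d \<mu> y"
      using pos by (simp add: zero_le_mult_iff)
    then show ?thesis by simp
  qed
  have nonneg: "0 \<le> ?d \<rho> y" for \<rho> y :: "nat \<Rightarrow> real" by (intro prod_nonneg) auto
  have "emeasure (obs_law n \<sigma> \<nu>) A
      \<le> (\<integral>\<^sup>+y. ennreal (?d \<mu> y) * indicator A y + ennreal (E / 4) * (ennreal (?d ?r y) * indicator A y) \<partial>?L)"
    unfolding em
  proof (rule nn_integral_mono)
    fix y
    have "ennreal (?d \<nu> y) \<le> ennreal (?d \<mu> y + E / 4 * ?d ?r y)"
      by (intro ennreal_leI ptw)
    also have "\<dots> = ennreal (?d \<mu> y) + ennreal (E / 4) * ennreal (?d ?r y)"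
      using E_pos nonneg by (simp only: ennreal_plus mult_nonneg_nonneg ennreal_mult)
    finally show "ennreal (?d \<nu> y) * indicator A y
        \<le> ennreal (?d \<mu> y) * indicator A y + ennreal (E / 4) * (ennreal (?d ?r y) * indicator A y)"
      by (auto simp: indicator_def)
  qed
  also have "\<dots> = emeasure (obs_law n \<sigma> \<mu>) A + ennreal (E / 4) * emeasure (obs_law n \<sigma> ?r) A"
    unfolding em
    by (subst nn_integral_add, (intro meas_A borel_measurable_times_ennreal borel_measurable_const)+,
        subst nn_integral_cmult[OF meas_A], rule refl)
  finally have le: "emeasure (obs_law n \<sigma> \<nu>) A
      \<le> emeasure (obs_law n \<sigma> \<mu>) A + ennreal (E / 4) * emeasure (obs_law n \<sigma> ?r) A" .
  interpret P: prob_space "obs_law n \<sigma> \<mu>" by (rule prob_space_obs_law[OF assms(1)])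
  interpret Q: prob_space "obs_law n \<sigma> \<nu>" by (rule prob_space_obs_law[OF assms(1)])
  interpret R: prob_space "obs_law n \<sigma> ?r" by (rule prob_space_obs_law[OF assms(1)])
  have "measure (obs_law n \<sigma> \<nu>) A \<le> measure (obs_law n \<sigma> \<mu>) A + E / 4 * measure (obs_law n \<sigma> ?r) A"
    using le E_pos
    by (simp add: P.emeasure_eq_measure Q.emeasure_eq_measure R.emeasure_eq_measure
        flip: ennreal_mult ennreal_plus)
  \<comment> \<open>The reflected law matters only through its total mass 1.\<close>
  also have "\<dots> \<le> measure (obs_law n \<sigma> \<mu>) A + E / 4"
    using E_pos R.prob_le_1[of A] mult_left_le[of "measure (obs_law n \<sigma> ?r) A" "E / 4"] by simp
  finally show ?thesis by (simp add: E_def)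
qed

section \<open>Design points that make convexity automatic\<close>

text \<open>With gaps \<open>q ^ i\<close> for \<open>q = a / b\<close>, the slope over gap
  \<open>i\<close> lies between \<open>a / q ^ i\<close> and \<open>b / q ^ i\<close>, and the
  latter equals \<open>a / q ^ (i + 1)\<close>. Successive slope ranges only touch, so slopes
  increase whatever the individual increments are.\<close>

lemma convex_seqs_design:
  assumes "0 < a" "a \<le> b"
  obtains x :: "nat \<Rightarrow> real" where "strict_mono x"
    and "\<And>n u. u \<in> space (Rn n) \<Longrightarrow>
      (\<And>i. i \<in> {1..<n} \<Longrightarrow> a \<le> u (i + 1) - u i \<and> u (i + 1) - u i \<le> b) \<Longrightarrow> u \<in> convex_seqs n x"
proof
  define q where "q = a / b"
  define x where "x = (\<lambda>i::nat. \<Sum>l<i. q ^ l)"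
  have q: "0 < q" "q * b = a" using assms by (auto simp: q_def)
  show "strict_mono x"
    using q by (auto simp: strict_mono_Suc_iff x_def)
  fix n u
  assume u: "u \<in> space (Rn n)"
    and inc: "\<And>i. i \<in> {1..<n} \<Longrightarrow> a \<le> u (i + 1) - u i \<and> u (i + 1) - u i \<le> b"
  have "(u i - u (i - 1)) / (x i - x (i - 1)) \<le> (u (i + 1) - u i) / (x (i + 1) - x i)"
    if i: "i \<in> {2..<n}" for i
  proof -
    obtain l where l: "i = Suc l" using i by (cases i) auto
    have b: "u i - u (i - 1) \<le> b" using inc[of l] i l by auto
    have a: "a \<le> u (i + 1) - u i" using inc[of i] i by auto
    have "(u i - u (i - 1)) / (x i - x (i - 1)) \<le> b / q ^ l"
      using b q by (simp add: l x_def divide_right_mono)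
    also have "\<dots> = a / q ^ i" using q by (simp add: l field_simps)
    also have "\<dots> \<le> (u (i + 1) - u i) / (x (i + 1) - x i)"
      using a q by (simp add: x_def divide_right_mono)
    finally show ?thesis .
  qed
  then show "u \<in> convex_seqs n x" using u by (simp add: convex_seqs_def)
qed

section \<open>Assouad's averaging argument\<close>

text \<open>The average count of bad coordinates over the hypercube is at least \<open>k / 4\<close>; since the count is bounded by
  \<open>k\<close>, it cannot be concentrated below \<open>k / 8\<close>.\<close>

lemma assouad_many_bad_coordinates:
  fixes P :: "nat set \<Rightarrow> 'a measure" and T :: "nat \<Rightarrow> nat set \<Rightarrow> 'a set"
  assumes "k > 0" and prob: "\<And>S. prob_space (P S)" and T: "\<And>j S. T j S \<in> sets (P S)"
    and pair: "\<And>j S. S \<subseteq> {..<k} \<Longrightarrow> j < k \<Longrightarrow>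
      measure (P S) (T j S) + measure (P (sym_diff S {j})) (T j (sym_diff S {j})) \<ge> 1 / 2"
  shows "\<exists>S\<subseteq>{..<k}. measure (P S)
    {y \<in> space (P S). real k / 8 \<le> real (card {j \<in> {..<k}. y \<in> T j S})} \<ge> 1 / 8"
proof (rule ccontr)
  define B where "B = (\<lambda>S. {y \<in> space (P S). real k / 8 \<le> real (card {j \<in> {..<k}. y \<in> T j S})})"
  assume "\<not> ?thesis"
  then have small: "measure (P S) (B S) < 1 / 8" if "S \<subseteq> {..<k}" for S
    using that by (auto simp: B_def not_le)
  have count: "real (card {j \<in> {..<k}. y \<in> T j S}) = (\<Sum>j<k. indicator (T j S) y)" for y S
    by (simp add: indicator_def sum.If_cases Int_def)
  have upper: "(\<Sum>j<k. measure (P S) (T j S)) < real k / 4" if S: "S \<subseteq> {..<k}" for S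
  proof -
    interpret prob_space "P S" by (rule prob)
    note [measurable] = T[of _ S]
    have B_sets: "B S \<in> sets (P S)"
      unfolding B_def count by measurable
    have intT: "integrable (P S) (\<lambda>y. indicator (T j S) y :: real)" for j
      by (intro integrable_real_indicator) (auto simp: T less_top[symmetric])
    have intB: "integrable (P S) (\<lambda>y. indicator (B S) y :: real)"
      using B_sets by (intro integrable_real_indicator) (auto simp: less_top[symmetric])
    have "(\<Sum>j<k. measure (P S) (T j S)) = (\<integral>y. (\<Sum>j<k. indicator (T j S) y) \<partial>P S)"
      using intT by (subst Bochner_Integration.integral_sum) (auto simp: T)
    \<comment> \<open>The count is below \<open>k / 8\<close> off \<open>B S\<close> and at most
      \<open>k\<close> on it; as \<open>B S\<close> has probability below 1/8, the mean stays below
      \<open>k / 4\<close>.\<close>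
    also have "\<dots> \<le> (\<integral>y. real k / 8 + real k * indicator (B S) y \<partial>P S)"
    proof (rule integral_mono)
      fix y assume y: "y \<in> space (P S)"
      have "card {j \<in> {..<k}. y \<in> T j S} \<le> card {..<k}" by (intro card_mono) auto
      then have le: "(\<Sum>j<k. indicator (T j S) y) \<le> real k" unfolding count[symmetric] by simp
      show "(\<Sum>j<k. indicator (T j S) y) \<le> real k / 8 + real k * indicator (B S) y"
      proof (cases "y \<in> B S")
        case True
        then show ?thesis using le by simp
      next
        case False
        then show ?thesis using y unfolding B_def count by auto
      qed
    qed (use intT intB in auto)
    also have "\<dots> = real k / 8 + real k * measure (P S) (B S)"
      using intB B_sets by (simp add: prob_space)
    also have "\<dots> < real k / 4" using small[OF S] assms(1) by (simp add: field_simps)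
    finally show ?thesis .
  qed
  have lower: "(\<Sum>S\<in>Pow {..<k}. measure (P S) (T j S)) \<ge> real (card (Pow {..<k})) / 4"
    if j: "j < k" for j
  proof -
    \<comment> \<open>Flipping bit \<open>j\<close> is an involution of the hypercube, so summing
      \<open>pair\<close> over all vertices counts every term twice.\<close>
    have flip: "(\<Sum>S\<in>Pow {..<k}. measure (P (sym_diff S {j})) (T j (sym_diff S {j})))
        = (\<Sum>S\<in>Pow {..<k}. measure (P S) (T j S))"
      using j by (intro sum.reindex_bij_witness[where i="\<lambda>S. sym_diff S {j}" and j="\<lambda>S. sym_diff S {j}"]) auto
    have "real (card (Pow {..<k})) / 2 = (\<Sum>S\<in>Pow {..<k}. 1 / 2)" by simp
    also have "\<dots> \<le> (\<Sum>S\<in>Pow {..<k}. measure (P S) (T j S)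
        + measure (P (sym_diff S {j})) (T j (sym_diff S {j})))"
      using pair j by (intro sum_mono) auto
    also have "\<dots> = 2 * (\<Sum>S\<in>Pow {..<k}. measure (P S) (T j S))"
      unfolding sum.distrib flip by simp
    finally show ?thesis by simp
  qed
  \<comment> \<open>Double counting: summed over coordinates and vertices, \<open>lower\<close>
    contradicts the strict \<open>upper\<close>.\<close>
  have "real k * (real (card (Pow {..<k})) / 4) = (\<Sum>j<k. real (card (Pow {..<k})) / 4)" by simp
  also have "\<dots> \<le> (\<Sum>j<k. \<Sum>S\<in>Pow {..<k}. measure (P S) (T j S))"
    using lower by (intro sum_mono) auto
  also have "\<dots> = (\<Sum>S\<in>Pow {..<k}. \<Sum>j<k. measure (P S) (T j S))" by (rule sum.swap)
  also have "\<dots> < (\<Sum>S\<in>Pow {..<k}. real k / 4)"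
    using upper by (intro sum_strict_mono) auto
  finally show False by simp
qed

section \<open>The hypercube of staircases\<close>

text \<open>The trend supplies the strictly positive increments that the design needs. Blocks are
  numbered from 0 while indices start at 1, hence \<open>i - 1\<close>; the last block may be
  incomplete.\<close>

definition block_seq :: "nat \<Rightarrow> nat \<Rightarrow> real \<Rightarrow> real \<Rightarrow> nat set \<Rightarrow> nat \<Rightarrow> real" where
  "block_seq n m V \<delta> S = (\<lambda>i\<in>{1..n}. V * real i / real n
     + \<delta> * (real ((i - 1) div m) + of_bool ((i - 1) div m \<in> S)))"

lemma block_seq_in_space: "block_seq n m V \<delta> S \<in> space (Rn n)"
  by (simp add: block_seq_def Rn_def space_PiM)

text \<open>Inside a block only the trend moves. At a boundary the step of height
  \<open>\<delta>\<close> absorbs a possible drop of the optional raise, so the rest changes by 0 to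
  \<open>2 * \<delta>\<close>.\<close>

lemma block_seq_increment:
  assumes "\<delta> \<ge> 0" "i \<in> {1..<n}"
  shows "V / n \<le> block_seq n m V \<delta> S (i + 1) - block_seq n m V \<delta> S i"
    and "block_seq n m V \<delta> S (i + 1) - block_seq n m V \<delta> S i \<le> V / n + 2 * \<delta>"
proof -
  define j where "j = (i - 1) div m"
  have "i = Suc (i - 1)" using assms(2) by simp
  then have "i div m = j \<or> i div m = Suc j"
    unfolding j_def by (metis div_Suc)
  moreover have "block_seq n m V \<delta> S (i + 1) - block_seq n m V \<delta> S i
      = V / n + \<delta> * (real (i div m) - real j + of_bool (i div m \<in> S) - of_bool (j \<in> S))"
    using assms(2) by (simp add: block_seq_def j_def add_divide_distrib algebra_simps)
  ultimately show "V / n \<le> block_seq n m V \<delta> S (i + 1) - block_seq n m V \<delta> S i"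
    and "block_seq n m V \<delta> S (i + 1) - block_seq n m V \<delta> S i \<le> V / n + 2 * \<delta>"
    using assms(1) by auto
qed

text \<open>The trend uses at most \<open>V\<close>, and the staircase at most
  \<open>\<delta> * (n / m + 1)\<close>, which is at most \<open>2 * n / m * \<delta>\<close>. With
  a single block the raise is common to both ends and cancels, so \<open>amp\<close> is asked only
  for \<open>m < n\<close>.\<close>

lemma block_seq_range:
  assumes "1 \<le> m" "m \<le> n" "\<delta> \<ge> 0" "V \<ge> 0"
    and amp: "m < n \<Longrightarrow> 2 * real n / real m * \<delta> \<le> V"
  shows "block_seq n m V \<delta> S n - block_seq n m V \<delta> S 1 \<le> 2 * V"
proof -
  have n: "n \<ge> 1" using assms by simp
  have "block_seq n m V \<delta> S n - block_seq n m V \<delta> S 1 = V - V / n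
      + \<delta> * (real ((n - 1) div m) + of_bool ((n - 1) div m \<in> S) - of_bool (0 \<in> S))"
    using n by (simp add: block_seq_def algebra_simps)
  also have "\<dots> \<le> V + V"
  proof (cases "m < n")
    case False
    then have "(n - 1) div m = 0" using assms n by simp
    moreover have "- (V / n) \<le> V" using assms(4) divide_nonneg_nonneg[of V "real n"] by linarith
    ultimately show ?thesis by simp
  next
    case True
    have "real ((n - 1) div m) \<le> real (n - 1) / real m" by (rule of_nat_div_le_of_nat)
    also have "\<dots> \<le> real n / real m" by (intro divide_right_mono) auto
    finally have "real ((n - 1) div m) + of_bool ((n - 1) div m \<in> S) - of_bool (0 \<in> S)
        \<le> real n / real m + 1" by simp
    also have "\<dots> \<le> 2 * real n / real m" using assms by (simp add: field_simps)
    finally have "\<delta> * (real ((n - 1) div m) + of_bool ((n - 1) div m \<in> S) - of_bool (0 \<in> S))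
        \<le> \<delta> * (2 * real n / real m)"
      using assms(3) by (rule mult_left_mono)
    also have "\<dots> \<le> V" using amp[OF True] by (simp only: mult.commute)
    finally show ?thesis using assms(4) by (intro add_mono) auto
  qed
  finally show ?thesis by simp
qed

section \<open>Lower bound for the loss over the hypercube\<close>

lemma estimator_component_measurable:
  assumes "\<mu>hat \<in> measurable (Rn n) (Rn n)" "i \<in> {1..n}"
  shows "(\<lambda>y. \<mu>hat y i) \<in> borel_measurable (Rn n)"
  using measurable_compose[OF assms(1), of "\<lambda>u. u i" borel] assms(2) by (simp add: Rn_def)

lemma loss_event_measurable:
  assumes "\<mu>hat \<in> measurable (Rn n) (Rn n)"
  shows "{y \<in> space (Rn n). r \<le> scaled_norm_sq n (\<lambda>i. \<mu>hat y i - \<mu> i)} \<in> sets (Rn n)"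
proof -
  have "(\<lambda>y. scaled_norm_sq n (\<lambda>i. \<mu>hat y i - \<mu> i)) \<in> borel_measurable (Rn n)"
    unfolding scaled_norm_sq_def using estimator_component_measurable[OF assms]
    by (intro borel_measurable_times borel_measurable_sum borel_measurable_power borel_measurable_diff) auto
  then show ?thesis by measurable
qed

text \<open>The 1/64 is a product: an eighth of the complete blocks is bad, each bad block loses a
  quarter of the separation \<open>m * \<delta>\<^sup>2\<close>, and the complete blocks cover at
  least half of the indices.\<close>

lemma block_seq_minimax:
  fixes \<sigma> \<delta> V :: real
  assumes m: "1 \<le> m" "m \<le> n" and "\<sigma> > 0" and amp: "real m * \<delta>\<^sup>2 \<le> \<sigma>\<^sup>2 / 4"
    and est: "\<mu>hat \<in> measurable (Rn n) (Rn n)"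
  shows "\<exists>S. measure (obs_law n \<sigma> (block_seq n m V \<delta> S))
    {y \<in> space (Rn n). scaled_norm_sq n (\<lambda>i. \<mu>hat y i - block_seq n m V \<delta> S i) \<ge> \<delta>\<^sup>2 / 64} \<ge> 1 / 8"
proof -
  define k where "k = n div m"
  define \<mu> where "\<mu> = block_seq n m V \<delta>"
  define B where "B = (\<lambda>j. {j * m + 1..j * m + m})"
  define L where "L = (\<lambda>j S y. \<Sum>i\<in>B j. (\<mu>hat y i - \<mu> S i)\<^sup>2)"
  \<comment> \<open>The averaging lemma asks for measurable events at every \<open>j\<close>; from
    \<open>k\<close> on a block may leave \<open>{1..n}\<close>, so its loss is replaced by
    0.\<close>
  define T where "T = (\<lambda>j S. {y \<in> space (Rn n). real m * \<delta>\<^sup>2 / 4 \<le> (if j < k then L j S y else 0)})"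
  have k: "k > 0" using m by (simp add: k_def div_greater_zero_iff)
  have n: "n > 0" using m by simp
  have B_sub: "B j \<subseteq> {1..n}" if "j < k" for j
  proof -
    have "(j + 1) * m \<le> k * m" using that by (intro mult_right_mono) auto
    also have "\<dots> \<le> n" by (simp add: k_def)
    finally show ?thesis by (auto simp: B_def)
  qed
  have B_idx: "(i - 1) div m = j" if "i \<in> B j" for i j
  proof -
    have "i - 1 = j * m + (i - 1 - j * m)" "i - 1 - j * m < m" using that m by (auto simp: B_def)
    then show ?thesis by (metis div_mult_self3 add.commute div_less add_0_right m(1) not_one_le_zero)
  qed
  have idx_B: "i \<in> B j" if "(i - 1) div m = j" "i \<ge> 1" for i j
  proof -
    have "i - 1 = j * m + (i - 1) mod m" "(i - 1) mod m < m" using that(1) m by auto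
    then show ?thesis using that(2) by (auto simp: B_def)
  qed
  have gap: "(\<mu> S i - \<mu> (sym_diff S {j}) i)\<^sup>2 = (if i \<in> B j then \<delta>\<^sup>2 else 0)" if "i \<in> {1..n}" for S i j
    using that B_idx[of i j] idx_B[of i j]
    by (auto simp: \<mu>_def block_seq_def algebra_simps)
  have L_meas: "(\<lambda>y. if j < k then L j S y else 0) \<in> borel_measurable (Rn n)" for j S
  proof (cases "j < k")
    case True
    then show ?thesis
      unfolding L_def using B_sub[of j] estimator_component_measurable[OF est]
      by (auto intro!: borel_measurable_sum borel_measurable_power borel_measurable_diff)
  qed simp
  have T_sets: "T j S \<in> sets (Rn n)" for j S
    unfolding T_def using L_meas[of j S] by measurable
  have pair: "measure (obs_law n \<sigma> (\<mu> S)) (T j S)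
      + measure (obs_law n \<sigma> (\<mu> (sym_diff S {j}))) (T j (sym_diff S {j})) \<ge> 1 / 2"
    if j: "j < k" for j S
  proof -
    define S' where "S' = sym_diff S {j}"
    interpret P: prob_space "obs_law n \<sigma> (\<mu> S)" by (rule prob_space_obs_law[OF assms(3)])
    interpret Q: prob_space "obs_law n \<sigma> (\<mu> S')" by (rule prob_space_obs_law[OF assms(3)])
    \<comment> \<open>The two block losses add up to at least half of the separation, so an estimate
      close to one vertex is far from the other.\<close>
    have cover: "y \<in> T j S" if y: "y \<in> space (Rn n)" "y \<notin> T j S'" for y
    proof -
      have "real m * \<delta>\<^sup>2 = (\<Sum>i\<in>B j. (\<mu> S i - \<mu> S' i)\<^sup>2)"
        using B_sub[OF j] gap by (simp add: S'_def subset_iff B_def)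
      also have "\<dots> \<le> (\<Sum>i\<in>B j. 2 * (\<mu>hat y i - \<mu> S i)\<^sup>2 + 2 * (\<mu>hat y i - \<mu> S' i)\<^sup>2)"
      proof (rule sum_mono)
        fix i
        have "(a - b)\<^sup>2 \<le> 2 * (h - a)\<^sup>2 + 2 * (h - b)\<^sup>2" for a b h :: real
          using zero_le_power2[of "(h - a) + (h - b)"] by (simp add: power2_eq_square algebra_simps)
        then show "(\<mu> S i - \<mu> S' i)\<^sup>2 \<le> 2 * (\<mu>hat y i - \<mu> S i)\<^sup>2 + 2 * (\<mu>hat y i - \<mu> S' i)\<^sup>2" .
      qed
      also have "\<dots> = 2 * L j S y + 2 * L j S' y"
        by (simp add: L_def sum.distrib sum_distrib_left)
      finally show ?thesis using y j by (auto simp: T_def)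
    qed
    define A where "A = space (Rn n) - T j S'"
    have A: "A \<in> sets (Rn n)" using T_sets by (auto simp: A_def)
    have "(\<Sum>i=1..n. (\<mu> S' i - \<mu> S i)\<^sup>2) = (\<Sum>i=1..n. if i \<in> B j then \<delta>\<^sup>2 else 0)"
      using gap by (intro sum.cong) (auto simp: S'_def power2_commute)
    also have "\<dots> = real m * \<delta>\<^sup>2"
      using B_sub[OF j] by (simp add: sum.If_cases Int_absorb1) (simp add: B_def)
    finally have "exp ((\<Sum>i=1..n. (\<mu> S' i - \<mu> S i)\<^sup>2) / \<sigma>\<^sup>2) \<le> exp (1 / 4)"
      using amp assms(3) by (simp add: field_simps)
    also have "\<dots> \<le> (2::real)" using exp_bound[of "1/4::real"] by (simp add: power2_eq_square)
    \<comment> \<open>An exponential factor of at most 2 makes the comparison error at most 1/2.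
      Since \<open>A\<close> is the complement of \<open>T j S'\<close> and lies in
      \<open>T j S\<close>, this is the bound on the pair.\<close>
    finally have "measure (obs_law n \<sigma> (\<mu> S')) A \<le> measure (obs_law n \<sigma> (\<mu> S)) A + 1 / 2"
      using measure_obs_law_le[OF assms(3) A, of "\<mu> S'" "\<mu> S"] by simp
    moreover have "measure (obs_law n \<sigma> (\<mu> S)) A \<le> measure (obs_law n \<sigma> (\<mu> S)) (T j S)"
      using cover T_sets by (intro P.finite_measure_mono) (auto simp: A_def)
    moreover have "measure (obs_law n \<sigma> (\<mu> S')) A = 1 - measure (obs_law n \<sigma> (\<mu> S')) (T j S')"
      unfolding A_def using Q.prob_compl[of "T j S'"] T_sets by simp
    ultimately show ?thesis by (simp add: S'_def)
  qed
  obtain S where S: "measure (obs_law n \<sigma> (\<mu> S))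
      {y \<in> space (Rn n). real k / 8 \<le> real (card {j \<in> {..<k}. y \<in> T j S})} \<ge> 1 / 8"
    using assouad_many_bad_coordinates[of k "\<lambda>S. obs_law n \<sigma> (\<mu> S)" T] k pair T_sets
      prob_space_obs_law[OF assms(3)] by auto
  interpret P: prob_space "obs_law n \<sigma> (\<mu> S)" by (rule prob_space_obs_law[OF assms(3)])
  have loss: "\<delta>\<^sup>2 / 64 \<le> scaled_norm_sq n (\<lambda>i. \<mu>hat y i - \<mu> S i)"
    if y: "real k / 8 \<le> real (card {j \<in> {..<k}. y \<in> T j S})" for y
  proof -
    \<comment> \<open>The incomplete block is shorter than one of the \<open>k\<close> complete
      ones, and \<open>k\<close> is positive.\<close>
    have "n mod m < m" using m by simp
    moreover have "n = k * m + n mod m" by (simp add: k_def)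
    moreover have "m \<le> k * m" using k by simp
    ultimately have "n \<le> 2 * (k * m)" by linarith
    then have "real n \<le> 2 * (real k * real m)" by (metis of_nat_le_iff of_nat_mult of_nat_numeral)
    then have "\<delta>\<^sup>2 / 64 * real n \<le> \<delta>\<^sup>2 / 64 * (2 * (real k * real m))" by (intro mult_left_mono) auto
    also have "\<dots> = real k / 8 * (real m * \<delta>\<^sup>2 / 4)" by simp
    also have "\<dots> \<le> real (card {j \<in> {..<k}. y \<in> T j S}) * (real m * \<delta>\<^sup>2 / 4)"
      using y by (intro mult_right_mono) auto
    also have "\<dots> = (\<Sum>j | j \<in> {..<k} \<and> y \<in> T j S. real m * \<delta>\<^sup>2 / 4)" by simp
    also have "\<dots> \<le> (\<Sum>j | j \<in> {..<k} \<and> y \<in> T j S. L j S y)"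
      by (intro sum_mono) (auto simp: T_def)
    also have "\<dots> \<le> (\<Sum>j<k. L j S y)"
      by (intro sum_mono2) (auto simp: L_def sum_nonneg)
    also have "\<dots> = (\<Sum>i\<in>(\<Union>j<k. B j). (\<mu>hat y i - \<mu> S i)\<^sup>2)"
    proof -
      have "B i \<inter> B j = {}" if "i \<noteq> j" for i j using B_idx that by blast
      moreover have "finite (B j)" for j by (simp add: B_def)
      ultimately show ?thesis unfolding L_def by (intro sum.UNION_disjoint[symmetric]) auto
    qed
    also have "\<dots> \<le> (\<Sum>i=1..n. (\<mu>hat y i - \<mu> S i)\<^sup>2)"
      using B_sub by (intro sum_mono2) auto
    finally show ?thesis using n by (simp add: scaled_norm_sq_def field_simps)
  qed
  have "measure (obs_law n \<sigma> (\<mu> S))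
        {y \<in> space (Rn n). real k / 8 \<le> real (card {j \<in> {..<k}. y \<in> T j S})}
      \<le> measure (obs_law n \<sigma> (\<mu> S))
        {y \<in> space (Rn n). \<delta>\<^sup>2 / 64 \<le> scaled_norm_sq n (\<lambda>i. \<mu>hat y i - \<mu> S i)}"
    using loss loss_event_measurable[OF est, of "\<delta>\<^sup>2 / 64" "\<mu> S"] by (intro P.finite_measure_mono) auto
  then show ?thesis using S by (auto simp: \<mu>_def intro!: exI[of _ S])
qed

section \<open>Choice of the block length\<close>

text \<open>The block length balances \<open>m \<delta>\<^sup>2 \<approx> \<sigma>\<^sup>2\<close> against the total variation \<open>(n / m) \<delta> \<approx> V\<close>. If \<open>V\<close> is
  too small for this, a single block remains and the family consists of constant shifts.\<close>

lemma block_length_exists: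
  fixes \<sigma> V :: real
  assumes "n \<ge> 1" "\<sigma> > 0" "V > 0" "V \<le> \<sigma> * real n"
  defines "\<rho> \<equiv> (V\<^sup>2 / (\<sigma>\<^sup>2 * (real n)\<^sup>2)) powr (1 / 3)"
  obtains m where "1 \<le> m" "m \<le> n" "real m * \<rho> \<le> 2"
    and "m < n \<Longrightarrow> 2 * real n / real m * (\<sigma> / (2 * sqrt (real m))) \<le> V"
proof -
  define w where "w = V\<^sup>2 / (\<sigma>\<^sup>2 * (real n)\<^sup>2)"
  have w: "0 < w" using assms by (simp add: w_def)
  have "V\<^sup>2 \<le> (\<sigma> * real n)\<^sup>2" using assms by (intro power_mono) auto
  then have w1: "w \<le> 1" using assms by (simp add: w_def power_mult_distrib)
  have \<rho>w: "\<rho> = w powr (1 / 3)" by (simp add: \<rho>_def w_def)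
  have \<rho>: "0 < \<rho>" using w by (simp add: \<rho>w)
  have \<rho>1: "\<rho> \<le> 1" unfolding \<rho>w using w w1 by (simp add: powr_le1)
  have \<rho>3: "\<rho> ^ 3 = w" using w by (simp add: \<rho>w powr_power)
  \<comment> \<open>The required bound reads \<open>\<sigma> * n / m powr (3/2) \<le> V\<close>,
    that is, \<open>m\<close> at least \<open>(\<sigma> * n / V) powr (2/3)\<close>, which is
    \<open>1 / \<rho>\<close>.\<close>
  define c where "c = nat \<lceil>1 / \<rho>\<rceil>"
  have c_ge: "1 / \<rho> \<le> real c" using \<rho> by (simp add: c_def)
  have c_le: "real c < 1 / \<rho> + 1" using \<rho> by (simp add: c_def) linarith
  have "1 \<le> 1 / \<rho>" using \<rho> \<rho>1 by simp
  then have c1: "1 \<le> c" using c_ge by linarith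
  \<comment> \<open>Rounding up costs at most a factor 2 because \<open>\<rho> \<le> 1\<close>,
    which comes from \<open>V \<le> \<sigma> * n\<close>.\<close>
  have "real c * \<rho> \<le> (1 / \<rho> + 1) * \<rho>" using c_le \<rho> by (intro mult_right_mono) auto
  also have "\<dots> \<le> 2" using \<rho> \<rho>1 by (simp add: field_simps)
  finally have c2: "real c * \<rho> \<le> 2" .
  show thesis
  \<comment> \<open>If \<open>c\<close> is at least \<open>n\<close>, one block fills all indices
    and the variation bound is vacuous.\<close>
  proof (rule that[of "min n c"])
    have "real (min n c) * \<rho> \<le> real c * \<rho>" using \<rho> by (intro mult_right_mono) auto
    then show "real (min n c) * \<rho> \<le> 2" using c2 by simp
    assume "min n c < n"
    then have mc: "min n c = c" by simp
    have "1 \<le> real c * \<rho>" using c_ge \<rho> by (simp add: field_simps)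
    then have "1 ^ 3 \<le> (real c * \<rho>) ^ 3" by (intro power_mono) auto
    then have "1 \<le> real c ^ 3 * w" by (simp add: power_mult_distrib \<rho>3)
    then have *: "(\<sigma> * real n)\<^sup>2 \<le> V\<^sup>2 * real c ^ 3"
      using assms by (simp add: w_def field_simps)
    have "\<sigma> * real n \<le> sqrt (V\<^sup>2 * real c ^ 3)"
      by (rule real_le_rsqrt[OF *])
    also have "\<dots> = V * (real c * sqrt (real c))"
      using assms by (simp add: real_sqrt_mult power3_eq_cube)
    finally show "2 * real n / real (min n c) * (\<sigma> / (2 * sqrt (real (min n c)))) \<le> V"
      unfolding mc using c1 by (simp add: field_simps)
  qed (use assms c1 in auto)
qed

section \<open>The minimax bound for convex nondecreasing sequences\<close>

theorem theorem4p5: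
  shows "\<exists>c C :: real. c > 0 \<and> C > 0 \<and>
    (\<forall>(n::nat) (\<sigma>::real) (V::real). n \<ge> 1 \<longrightarrow> \<sigma> > 0 \<longrightarrow> V > 0 \<longrightarrow> V \<le> \<sigma> * real n \<longrightarrow>
      (\<exists>x :: nat \<Rightarrow> real. strict_mono_on {1..n} x \<and>
        (\<forall>\<mu>hat \<in> measurable (Rn n) (Rn n).
          (SUP \<mu> \<in> {\<mu> \<in> convex_seqs n x \<inter> nondecreasing_seqs n. \<mu> n - \<mu> 1 \<le> 2 * V}.
             measure (obs_law n \<sigma> \<mu>)
               {y \<in> space (Rn n). scaled_norm_sq n (\<lambda>i. \<mu>hat y i - \<mu> i)
                  \<ge> C * \<sigma>\<^sup>2 * (V\<^sup>2 / (\<sigma>\<^sup>2 * (real n)\<^sup>2)) powr (1 / 3)}) \<ge> c)))"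
proof (rule exI[of _ "1 / 8"], rule exI[of _ "1 / 512"], intro conjI allI impI)
  fix n :: nat and \<sigma> V :: real
  assume n: "n \<ge> 1" and \<sigma>: "\<sigma> > 0" and V: "V > 0" and V_le: "V \<le> \<sigma> * real n"
  define \<rho> where "\<rho> = (V\<^sup>2 / (\<sigma>\<^sup>2 * (real n)\<^sup>2)) powr (1 / 3)"
  obtain m where m: "1 \<le> m" "m \<le> n" "real m * \<rho> \<le> 2"
    and var: "m < n \<Longrightarrow> 2 * real n / real m * (\<sigma> / (2 * sqrt (real m))) \<le> V"
    using block_length_exists[OF n \<sigma> V V_le] unfolding \<rho>_def by metis
  \<comment> \<open>The solution of
    \<open>m * \<delta>\<^sup>2 = \<sigma>\<^sup>2 / 4\<close>.\<close>
  define \<delta> where "\<delta> = \<sigma> / (2 * sqrt (real m))"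
  have \<delta>: "\<delta> > 0" using \<sigma> m by (simp add: \<delta>_def)
  have \<delta>2: "\<delta>\<^sup>2 = \<sigma>\<^sup>2 / (4 * real m)" by (simp add: \<delta>_def power_divide power_mult_distrib)
  \<comment> \<open>Here \<open>\<delta>\<^sup>2 / 64\<close> is
    \<open>\<sigma>\<^sup>2 / (256 * m)\<close>, and \<open>\<rho> \<le> 2 / m\<close> turns 256
    into 512.\<close>
  have rate: "1 / 512 * \<sigma>\<^sup>2 * \<rho> \<le> \<delta>\<^sup>2 / 64"
  proof -
    have "\<sigma>\<^sup>2 * (real m * \<rho>) \<le> \<sigma>\<^sup>2 * 2" using m by (intro mult_left_mono) auto
    then show ?thesis unfolding \<delta>2 using m by (simp add: field_simps)
  qed
  \<comment> \<open>The increment bounds involve neither \<open>S\<close> nor the estimator, so one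
    design serves all estimators.\<close>
  obtain x :: "nat \<Rightarrow> real" where x: "strict_mono x"
    and conv: "\<And>n' u. u \<in> space (Rn n') \<Longrightarrow>
      (\<And>i. i \<in> {1..<n'} \<Longrightarrow> V / n \<le> u (i + 1) - u i \<and> u (i + 1) - u i \<le> V / n + 2 * \<delta>) \<Longrightarrow>
      u \<in> convex_seqs n' x"
    using convex_seqs_design[of "V / n" "V / n + 2 * \<delta>"] n V \<delta> by auto
  show "\<exists>x :: nat \<Rightarrow> real. strict_mono_on {1..n} x \<and>
        (\<forall>\<mu>hat \<in> measurable (Rn n) (Rn n).
          (SUP \<mu> \<in> {\<mu> \<in> convex_seqs n x \<inter> nondecreasing_seqs n. \<mu> n - \<mu> 1 \<le> 2 * V}.
             measure (obs_law n \<sigma> \<mu>)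
               {y \<in> space (Rn n). scaled_norm_sq n (\<lambda>i. \<mu>hat y i - \<mu> i)
                  \<ge> 1 / 512 * \<sigma>\<^sup>2 * (V\<^sup>2 / (\<sigma>\<^sup>2 * (real n)\<^sup>2)) powr (1 / 3)}) \<ge> 1 / 8)"
    unfolding \<rho>_def[symmetric]
  proof (intro exI[of _ x] conjI ballI)
    show "strict_mono_on {1..n} x" using x by (auto simp: strict_mono_on_def strict_mono_def)
    fix \<mu>hat assume est: "\<mu>hat \<in> measurable (Rn n) (Rn n)"
    let ?K = "{\<mu> \<in> convex_seqs n x \<inter> nondecreasing_seqs n. \<mu> n - \<mu> 1 \<le> 2 * V}"
    let ?E = "\<lambda>r \<mu>. {y \<in> space (Rn n). scaled_norm_sq n (\<lambda>i. \<mu>hat y i - \<mu> i) \<ge> r}"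
    obtain S where S: "measure (obs_law n \<sigma> (block_seq n m V \<delta> S)) (?E (\<delta>\<^sup>2 / 64) (block_seq n m V \<delta> S)) \<ge> 1 / 8"
      using block_seq_minimax[of m n \<sigma> \<delta> \<mu>hat V] m \<sigma> est by (auto simp: \<delta>2)
    define \<mu> where "\<mu> = block_seq n m V \<delta> S"
    note inc = block_seq_increment[where m = m and n = n and V = V and S = S and \<delta> = \<delta>, folded \<mu>_def]
    have "\<mu> \<in> convex_seqs n x"
      using \<delta> inc block_seq_in_space[of n m V \<delta> S, folded \<mu>_def] by (intro conv) auto
    moreover have "\<mu> \<in> nondecreasing_seqs n"
    proof -
      have "\<mu> i \<le> \<mu> (i + 1)" if "i \<in> {1..<n}" for i
        using inc(1)[OF less_imp_le[OF \<delta>] that] divide_nonneg_nonneg[of V "real n"] V by linarith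
      then show ?thesis
        using block_seq_in_space[of n m V \<delta> S, folded \<mu>_def] by (simp add: nondecreasing_seqs_def)
    qed
    moreover have "\<mu> n - \<mu> 1 \<le> 2 * V"
      unfolding \<mu>_def using m \<delta> V var by (intro block_seq_range) (auto simp: \<delta>_def)
    ultimately have \<mu>K: "\<mu> \<in> ?K" by simp
    interpret P: prob_space "obs_law n \<sigma> \<mu>" by (rule prob_space_obs_law[OF \<sigma>])
    have "measure (obs_law n \<sigma> \<mu>) (?E (\<delta>\<^sup>2 / 64) \<mu>)
        \<le> measure (obs_law n \<sigma> \<mu>) (?E (1 / 512 * \<sigma>\<^sup>2 * \<rho>) \<mu>)"
      using loss_event_measurable[OF est, of "1 / 512 * \<sigma>\<^sup>2 * \<rho>" \<mu>]
      by (intro P.finite_measure_mono) (use rate order_trans in \<open>blast, simp\<close>)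
    then have "1 / 8 \<le> measure (obs_law n \<sigma> \<mu>) (?E (1 / 512 * \<sigma>\<^sup>2 * \<rho>) \<mu>)"
      using S by (simp add: \<mu>_def)
    \<comment> \<open>A real \<open>SUP\<close> dominates its members only if they are bounded
      above; probabilities are bounded by 1.\<close>
    also have "\<dots> \<le> (SUP \<mu>\<in>?K. measure (obs_law n \<sigma> \<mu>) (?E (1 / 512 * \<sigma>\<^sup>2 * \<rho>) \<mu>))"
      using \<mu>K prob_space.prob_le_1[OF prob_space_obs_law[OF \<sigma>]]
      by (intro cSUP_upper bdd_aboveI2[where M = 1]) auto
    finally show "1 / 8 \<le> (SUP \<mu>\<in>?K. measure (obs_law n \<sigma> \<mu>) (?E (1 / 512 * \<sigma>\<^sup>2 * \<rho>) \<mu>))" .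
  qed
qed auto

end
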